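(* Let $G$ and $H$ be finite simple connected graphs. If the strong product $G\boxtimes H$ is a DP graph, then both $G$ and $H$ are DP graphs.
   Context: All graphs are finite, simple and connected. For a graph $G$, $A_i(G)$ is the $i$-th distance matrix: the $0/1$ matrix indexed by $V(G)$ with $(u,v)$-entry $1$ iff $d(u,v)=i$; $A_1(G)$ is the adjacency matrix. $G$ is DP (distance-polynomial) if for every $1\le i\le\operatorname{diam}(G)$ the matrix $A_i(G)$ is a polynomial in $A_1(G)$. The strong product $G\boxtimes H$ has vertex set $V(G)\times V(H)$, and $(g_1,h_1)\sim(g_2,h_2)$ iff ($g_1\sim g_2$ and $h_1=h_2$) or ($g_1=g_2$ and $h_1\sim h_2$) or ($g_1\sim g_2$ and $h_1\sim h_2$). *)

theory Defs
  imports
    "HOL-Analysis.Analysis"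
    "HOL-Computational_Algebra.Polynomial"
    "Graph_Theory.Graph_Theory"
begin

text \<open>
  Finite simple graphs are the \<open>pair_graph\<close>s of \<open>Graph_Theory\<close> (finite, symmetric, loop-free
  digraphs whose arcs are pairs of vertices).  Matrices indexed by the vertices are of type
  \<open>real ^ 'v ^ 'v\<close>, so the definitions involving matrices are meaningful only for graphs whose
  vertex set is the whole finite type \<open>'v\<close>.  Every nonempty finite graph has such a
  representation, up to isomorphism.
\<close>

text \<open>The library's shortest-path distance, with all arcs of weight 1 (infinite if there is
  no walk).\<close>

definition graph_dist :: "'v pair_pre_digraph \<Rightarrow> 'v \<Rightarrow> 'v \<Rightarrow> ereal" where
  "graph_dist G u v = wf_digraph.\<mu> (with_proj G) (\<lambda>_. 1) u v"

definition graph_diam :: "'v pair_pre_digraph \<Rightarrow> ereal" where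
  "graph_diam G = (SUP u\<in>pverts G. SUP v\<in>pverts G. graph_dist G u v)"

definition distance_matrix :: "'v::finite pair_pre_digraph \<Rightarrow> nat \<Rightarrow> real ^ 'v ^ 'v" where
  "distance_matrix G i = (\<chi> u v. if graph_dist G u v = ereal (real i) then 1 else 0)"

text \<open>The power operation \<open>^\<close> on the type \<open>real ^ 'n ^ 'n\<close> would be entrywise, hence a separate
  power for the matrix product.\<close>

primrec matrix_power :: "real ^ 'n ^ 'n \<Rightarrow> nat \<Rightarrow> real ^ 'n ^ 'n" where
  "matrix_power A 0 = mat 1"
| "matrix_power A (Suc k) = A ** matrix_power A k"

definition poly_matrix :: "real poly \<Rightarrow> real ^ 'n ^ 'n \<Rightarrow> real ^ 'n ^ 'n" where
  "poly_matrix p A = (\<Sum>k\<le>degree p. coeff p k *\<^sub>R matrix_power A k)"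

definition distance_polynomial_graph :: "'v::finite pair_pre_digraph \<Rightarrow> bool" where
  "distance_polynomial_graph G \<longleftrightarrow>
     (\<forall>i::nat. 1 \<le> i \<and> ereal (real i) \<le> graph_diam G \<longrightarrow>
        (\<exists>p :: real poly. distance_matrix G i = poly_matrix p (distance_matrix G 1)))"

definition strong_product ::
    "'a pair_pre_digraph \<Rightarrow> 'b pair_pre_digraph \<Rightarrow> ('a \<times> 'b) pair_pre_digraph"
    (infixl \<open>\<boxtimes>\<close> 70) where
  "G \<boxtimes> H = \<lparr> pverts = pverts G \<times> pverts H,
     parcs = {((g1, h1), (g2, h2)). g1 \<in> pverts G \<and> g2 \<in> pverts G \<and> h1 \<in> pverts H \<and> h2 \<in> pverts H \<and>
       ((g1, g2) \<in> parcs G \<and> h1 = h2 \<or>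
        g1 = g2 \<and> (h1, h2) \<in> parcs H \<or>
        (g1, g2) \<in> parcs G \<and> (h1, h2) \<in> parcs H)} \<rparr>"

lemma pair_graph_strong_product:
  assumes "pair_graph G" and "pair_graph H"
  shows "pair_graph (G \<boxtimes> H)"
proof -
  interpret G: pair_graph G by fact
  interpret H: pair_graph H by fact
  have fin: "finite (pverts G \<times> pverts H)"
    using G.pair_finite_verts H.pair_finite_verts by simp
  have sub: "parcs (G \<boxtimes> H) \<subseteq> (pverts G \<times> pverts H) \<times> (pverts G \<times> pverts H)"
    by (auto simp: strong_product_def)
  have irr: "(x, x) \<notin> parcs G" "(y, y) \<notin> parcs H" for x y
    using G.pair_no_loops H.pair_no_loops by fastforce+
  have symG: "(y, x) \<in> parcs G" if "(x, y) \<in> parcs G" for x y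
    using G.pair_sym_arcs that by (auto simp: symmetric_def sym_def)
  have symH: "(y, x) \<in> parcs H" if "(x, y) \<in> parcs H" for x y
    using H.pair_sym_arcs that by (auto simp: symmetric_def sym_def)
  show ?thesis
  proof
    show "finite (pverts (G \<boxtimes> H))" using fin by (simp add: strong_product_def)
    show "finite (parcs (G \<boxtimes> H))" using fin sub by (meson finite_SigmaI finite_subset)
    show "symmetric (with_proj (G \<boxtimes> H))"
      by (auto simp: symmetric_def sym_def strong_product_def dest: symG symH)
    show "fst e \<noteq> snd e" if "e \<in> parcs (G \<boxtimes> H)" for e
      using that irr by (auto simp: strong_product_def)
  qed (auto simp: strong_product_def)
qed

lemma distance_matrix_1:
  assumes "pair_graph G"
  shows "distance_matrix G 1 $ u $ v = (if (u, v) \<in> parcs G then 1 else 0)"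
proof -
  interpret pair_graph G by fact
  have cost: "awalk_cost (\<lambda>_. 1) p = real (length p)" for p :: "('a \<times> 'a) list"
    by (simp add: awalk_cost_def sum_list_triv)
  have dist: "graph_dist G u v = (INF p\<in>{p. awalk u p v}. ereal (real (length p)))"
    unfolding graph_dist_def by (simp add: \<mu>_def cost)
  have "graph_dist G u v = 1 \<longleftrightarrow> (u, v) \<in> parcs G"
  proof
    assume arc: "(u, v) \<in> parcs G"
    then have "awalk u [(u, v)] v"
      by (auto simp: awalk_def in_arcsD1)
    then have "graph_dist G u v \<le> 1"
      unfolding dist by (intro INF_lower2[of "[(u, v)]"]) auto
    moreover have "1 \<le> graph_dist G u v"
      unfolding dist
    proof (intro INF_greatest)
      fix p assume "p \<in> {p. awalk u p v}"
      then have "p \<noteq> []" using arc pair_no_loops by (fastforce simp: awalk_def)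
      then show "1 \<le> ereal (real (length p))" by (cases p) auto
    qed
    ultimately show "graph_dist G u v = 1" by (rule antisym)
  next
    assume d: "graph_dist G u v = 1"
    have "(INF p\<in>{p. awalk u p v}. ereal (real (length p))) < 2"
      using d dist by (metis one_less_numeral_iff semiring_norm(76) ereal_less(3) numeral_eq_ereal one_ereal_def less_ereal.simps(1))
    then obtain p where p: "awalk u p v" "ereal (real (length p)) < 2"
      by (auto simp: INF_less_iff)
    have "1 \<le> ereal (real (length p))"
      using p(1) d dist by (metis INF_lower mem_Collect_eq)
    with p(2) have "length p = 1" by simp
    then obtain e where "p = [e]" by (cases p) auto
    with p(1) show "(u, v) \<in> parcs G" by (auto simp: awalk_def)
  qed
  then show ?thesis by (simp add: distance_matrix_def one_ereal_def)
qed

end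

theory Submission
  imports Defs
begin

text \<open>
  The idea is to regard a matrix \<open>M\<close> on the vertices of \<open>G \<boxtimes> H\<close> as a matrix, indexed by the
  vertices of \<open>H\<close>, whose entries (blocks) are matrices on the vertices of \<open>G\<close>.  Every block of
  the adjacency matrix of \<open>G \<boxtimes> H\<close> is one of \<open>A\<close>, \<open>A + I\<close> and \<open>0\<close>, where \<open>A\<close> is the adjacency
  matrix of \<open>G\<close>.  All of these lie in the algebra of polynomials in \<open>A\<close>, and block matrices over
  an algebra are closed under sums and products.  Hence all blocks of a polynomial in the
  adjacency matrix of \<open>G \<boxtimes> H\<close> are polynomials in \<open>A\<close> (\<open>blocks_of_polynomial\<close>).

  On the other hand, a layer \<open>V(G) \<times> {h}\<close> is isometric to \<open>G\<close>, because the projection to \<open>G\<close>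
  and the inclusion of the layer both map an arc to an arc or to a single vertex, and such maps
  cannot increase distances (\<open>graph_dist_image_le\<close>).  So the diagonal block of \<open>A\<^sub>i(G \<boxtimes> H)\<close> at
  \<open>h\<close> is \<open>A\<^sub>i(G)\<close>.  If \<open>A\<^sub>i(G \<boxtimes> H)\<close> is a polynomial in the adjacency matrix of \<open>G \<boxtimes> H\<close>, then
  \<open>A\<^sub>i(G)\<close> is therefore a polynomial in \<open>A\<close>.

  The vertices of the product are parametrized by an arbitrary bijection from pairs, so that the
  same argument covers both factors.
\<close>

section \<open>Polynomials in a matrix\<close>

lemma poly_matrix_extend:
  assumes "degree p \<le> n"
  shows "poly_matrix p A = (\<Sum>k\<le>n. coeff p k *\<^sub>R matrix_power A k)"
  unfolding poly_matrix_def
  by (rule sum.mono_neutral_left) (use assms in \<open>auto simp: coeff_eq_0\<close>)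

lemma poly_matrix_add: "poly_matrix (p + q) A = poly_matrix p A + poly_matrix q A"
proof -
  let ?n = "max (degree p) (degree q)"
  have "degree (p + q) \<le> ?n" by (rule degree_add_le_max)
  then show ?thesis
    by (simp add: poly_matrix_extend[of _ ?n] scaleR_add_left sum.distrib)
qed

lemma poly_matrix_smult: "poly_matrix (smult c p) A = c *\<^sub>R poly_matrix p A"
  by (simp add: poly_matrix_extend[of _ "degree p"] degree_smult_le scaleR_sum_right)

lemma poly_matrix_monom: "poly_matrix (monom 1 k) A = matrix_power A k"
proof -
  have "coeff (monom 1 k) j *\<^sub>R matrix_power A j = (if j = k then matrix_power A k else 0)" for j
    by auto
  then show ?thesis
    by (simp add: poly_matrix_extend[of _ k] degree_monom_le sum.delta)
qed

text \<open>The span of the powers is more convenient than the polynomials themselves, as it is closed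
  under the vector space operations by construction and has an induction principle.\<close>

lemma polynomial_iff_span:
  "(\<exists>p. M = poly_matrix p A) \<longleftrightarrow> M \<in> span (range (matrix_power A))"
proof
  assume "\<exists>p. M = poly_matrix p A"
  then show "M \<in> span (range (matrix_power A))"
    unfolding poly_matrix_def by (elim exE) (simp add: span_sum span_scale span_base)
next
  have zero: "poly_matrix 0 A = 0" by (simp add: poly_matrix_def)
  have "subspace (range (\<lambda>p. poly_matrix p A))"
    unfolding subspace_def
    by (auto simp flip: poly_matrix_add poly_matrix_smult) (metis zero rangeI)
  moreover have "range (matrix_power A) \<subseteq> range (\<lambda>p. poly_matrix p A)"
    by (auto simp flip: poly_matrix_monom)
  ultimately have "span (range (matrix_power A)) \<subseteq> range (\<lambda>p. poly_matrix p A)"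
    by (rule span_minimal[rotated])
  then show "M \<in> span (range (matrix_power A)) \<Longrightarrow> \<exists>p. M = poly_matrix p A" by auto
qed

lemma mat_1_in_span_powers: "mat 1 \<in> span (range (matrix_power A))"
  by (metis matrix_power.simps(1) rangeI span_base)

lemma matrix_in_span_powers: "A \<in> span (range (matrix_power A))"
  by (metis matrix_power.simps matrix_mul_rid rangeI span_base)

lemma matrix_mult_in_span_powers:
  assumes "M \<in> span (range (matrix_power A))"
  shows "A ** M \<in> span (range (matrix_power A))"
  using assms
proof (induction rule: span_induct_alt)
  case base
  then show ?case by (simp add: span_zero)
next
  case (step c x y)
  then obtain k where "A ** x = matrix_power A (Suc k)" by auto
  then have "A ** x \<in> span (range (matrix_power A))" by (metis rangeI span_base)
  then have "c *\<^sub>R (A ** x) + A ** y \<in> span (range (matrix_power A))"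
    by (intro span_add span_scale step.IH)
  then show ?case
    by (simp add: matrix_add_ldistrib matrix_scalar_ac scalar_matrix_assoc)
qed

section \<open>Blocks\<close>

definition block :: "('b \<Rightarrow> 'a \<Rightarrow> 'c) \<Rightarrow> real ^ 'c ^ 'c \<Rightarrow> 'b \<Rightarrow> 'b \<Rightarrow> real ^ 'a ^ 'a" where
  "block f M h h' = (\<chi> g g'. M $ f h g $ f h' g')"

lemma block_mult:
  fixes f :: "'b::finite \<Rightarrow> 'a::finite \<Rightarrow> 'c::finite"
  assumes "bij (\<lambda>(h, g). f h g)"
  shows "block f (M ** N) h h' = (\<Sum>k\<in>UNIV. block f M h k ** block f N k h')"
proof -
  have "(\<Sum>x\<in>UNIV. F x) = (\<Sum>k\<in>UNIV. \<Sum>g\<in>UNIV. F (f k g))" for F :: "'c \<Rightarrow> real"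
    using sum.reindex_bij_betw[OF assms, of F]
    by (simp add: sum.cartesian_product case_prod_beta)
  then show ?thesis
    by (simp add: block_def matrix_matrix_mult_def vec_eq_iff sum_component)
qed

lemma block_mat_1:
  assumes "bij (\<lambda>(h, g). f h g)"
  shows "block f (mat 1) h h' = (if h = h' then mat 1 else 0)"
proof -
  have "f h g = f h' g' \<longleftrightarrow> h = h' \<and> g = g'" for g g'
    using bij_is_inj[OF assms] by (auto dest: injD[where x = "(h, g)" and y = "(h', g')"])
  then show ?thesis by (auto simp: block_def mat_def vec_eq_iff)
qed

text \<open>Multiplication by \<open>0\<close>, \<open>A\<close> or \<open>A + I\<close> preserves the polynomials in \<open>A\<close>, so by the product
  rule for blocks multiplication by \<open>M\<close> preserves the matrices all of whose blocks are such
  polynomials.  The identity is one of these, hence so is every power of \<open>M\<close>.\<close>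

lemma blocks_of_polynomial:
  fixes f :: "'b::finite \<Rightarrow> 'a::finite \<Rightarrow> 'c::finite"
  assumes f: "bij (\<lambda>(h, g). f h g)"
    and blocks: "\<And>h h'. block f M h h' \<in> {0, A, A + mat 1}"
    and N: "N \<in> span (range (matrix_power M))"
  shows "block f N h h' \<in> span (range (matrix_power A))"
proof -
  let ?S = "span (range (matrix_power A))"
  have mult: "block f M h k ** B \<in> ?S" if "B \<in> ?S" for h k B
  proof -
    have "(A + mat 1) ** B = A ** B + mat 1 ** B"
      by (simp add: matrix_matrix_mult_def vec_eq_iff distrib_right sum.distrib)
    then have "block f M h k ** B \<in> {0, A ** B, A ** B + B}"
      using blocks[of h k] by auto
    moreover have AB: "A ** B \<in> ?S" by (rule matrix_mult_in_span_powers[OF that])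
    ultimately show ?thesis
      using span_add[OF AB that] span_zero by auto
  qed
  have power: "block f (matrix_power M n) h h' \<in> ?S" for n h h'
  proof (induction n arbitrary: h)
    case 0
    then show ?case by (simp add: block_mat_1[OF f] mat_1_in_span_powers span_zero)
  next
    case (Suc n)
    then show ?case by (simp add: block_mult[OF f] span_sum mult)
  qed
  show ?thesis
    using N
  proof (induction rule: span_induct_alt)
    case base
    have "block f 0 h h' = 0" by (simp add: block_def vec_eq_iff)
    then show ?case by (simp add: span_zero)
  next
    case (step c x y)
    have "block f (c *\<^sub>R x + y) h h' = c *\<^sub>R block f x h h' + block f y h h'"
      by (simp add: block_def vec_eq_iff)
    moreover have "block f x h h' \<in> ?S" using step.hyps power by auto
    ultimately show ?case using step.IH by (simp add: span_add span_scale)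
  qed
qed

section \<open>Distances\<close>

lemma graph_dist_eq_INF:
  assumes "pair_graph G"
  shows "graph_dist G u v =
    (INF p\<in>{p. pre_digraph.awalk (with_proj G) u p v}. ereal (real (length p)))"
proof -
  interpret pair_graph G by fact
  have "awalk_cost (\<lambda>_. 1) p = real (length p)" for p :: "('a \<times> 'a) list"
    by (simp add: awalk_cost_def sum_list_triv)
  then show ?thesis by (simp add: graph_dist_def \<mu>_def)
qed

text \<open>A walk is mapped to a walk that is at most as long: the arcs whose ends are identified are
  dropped.\<close>

lemma graph_dist_image_le:
  fixes f :: "'a \<Rightarrow> 'b"
  assumes "pair_graph G" and "pair_graph H"
    and verts: "\<And>x. x \<in> pverts G \<Longrightarrow> f x \<in> pverts H"
    and arcs: "\<And>x y. (x, y) \<in> parcs G \<Longrightarrow> f x = f y \<or> (f x, f y) \<in> parcs H"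
  shows "graph_dist H (f u) (f v) \<le> graph_dist G u v"
proof -
  interpret G: pair_graph G by fact
  interpret H: pair_graph H by fact
  have "\<exists>q. H.awalk (f u) q (f v) \<and> length q \<le> length p" if "G.awalk u p v" for p
    using that
  proof (induction p arbitrary: u)
    case Nil
    then show ?case by (intro exI[of _ "[]"]) (auto simp: G.awalk_Nil_iff H.awalk_Nil_iff verts)
  next
    case (Cons e p)
    obtain w where e: "e = (u, w)" "(u, w) \<in> parcs G" and p: "G.awalk w p v"
      using Cons.prems by (cases e) (auto simp: G.awalk_Cons_iff)
    obtain q where q: "H.awalk (f w) q (f v)" "length q \<le> length p"
      using Cons.IH[OF p] by auto
    show ?case
    proof (cases "f u = f w")
      case True
      with q show ?thesis by (intro exI[of _ q]) auto
    next
      case False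
      with arcs[OF e(2)] q show ?thesis
        by (intro exI[of _ "(f u, f w) # q"]) (auto simp: H.awalk_Cons_iff)
    qed
  qed
  then show ?thesis
    unfolding graph_dist_eq_INF[OF assms(1)] graph_dist_eq_INF[OF assms(2)]
    by (intro INF_mono) auto
qed

text \<open>For an index up to the diameter this is the definition of a distance-polynomial graph; for
  a larger index the distance matrix is zero.\<close>

lemma distance_matrix_in_span_powers:
  assumes "distance_polynomial_graph G" and "pverts G = UNIV" and "1 \<le> i"
  shows "distance_matrix G i \<in> span (range (matrix_power (distance_matrix G 1)))"
proof (cases "ereal (real i) \<le> graph_diam G")
  case True
  with assms show ?thesis
    by (auto simp: distance_polynomial_graph_def simp flip: polynomial_iff_span)
next
  case False
  have "graph_dist G u v \<le> graph_diam G" for u v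
    unfolding graph_diam_def by (auto simp: assms(2) intro: SUP_upper2)
  with False have "graph_dist G u v \<noteq> ereal (real i)" for u v by metis
  then have "distance_matrix G i = 0" by (simp add: distance_matrix_def vec_eq_iff)
  then show ?thesis by (simp add: span_zero)
qed

section \<open>Factors of a strong product\<close>

text \<open>Here \<open>K\<close> is a strong product of \<open>G\<close> and \<open>H\<close> whose vertices are named by \<open>f\<close>, with the
  coordinate in \<open>H\<close> first since it is the index of the blocks.  Taking \<open>f h g\<close> to be \<open>(g, h)\<close>
  gives \<open>G \<boxtimes> H\<close> with \<open>G\<close> as the factor under consideration; exchanging the roles of the two
  coordinates gives the same graph with \<open>H\<close> in that place.\<close>

lemma distance_polynomial_factor:
  fixes G :: "'a::finite pair_pre_digraph" and H :: "'b::finite pair_pre_digraph"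
    and K :: "'c::finite pair_pre_digraph"
  assumes G: "pair_graph G" "pverts G = UNIV" and H: "pair_graph H"
    and K: "pair_graph K" "pverts K = UNIV"
    and f: "bij (\<lambda>(h, g). f h g)"
    and arcs: "\<And>h g h' g'. (f h g, f h' g') \<in> parcs K \<longleftrightarrow>
      (g, g') \<in> parcs G \<and> h = h' \<or> g = g' \<and> (h, h') \<in> parcs H \<or>
      (g, g') \<in> parcs G \<and> (h, h') \<in> parcs H"
    and DP: "distance_polynomial_graph K"
  shows "distance_polynomial_graph G"
proof -
  interpret G: pair_graph G by (rule G)
  interpret H: pair_graph H by (rule H)
  have no_loop: "(g, g) \<notin> parcs G" "(h, h) \<notin> parcs H" for g h
    using G.pair_no_loops H.pair_no_loops by fastforce+
  have blocks: "block f (distance_matrix K 1) h h' \<in>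
      {0, distance_matrix G 1, distance_matrix G 1 + mat 1}" for h h'
  proof -
    have "block f (distance_matrix K 1) h h' =
      (if h = h' then distance_matrix G 1
       else if (h, h') \<in> parcs H then distance_matrix G 1 + mat 1 else 0)"
      using no_loop
      by (auto simp: block_def vec_eq_iff mat_def arcs distance_matrix_1[OF G(1), simplified]
          distance_matrix_1[OF K(1), simplified])
    then show ?thesis by auto
  qed
  \<comment> \<open>the projection to \<open>G\<close>\<close>
  obtain \<pi> where \<pi>: "\<pi> (f h g) = g" for h g
  proof
    show "snd (inv (\<lambda>(h, g). f h g) (f h g)) = g" for h g
      using inv_f_f[OF bij_is_inj[OF f], of "(h, g)"] by simp
  qed
  have surj: "\<exists>h g. x = f h g" for x
    using bij_is_surj[OF f] by (metis surjD case_prod_beta)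
  have layer: "graph_dist K (f h g) (f h g') = graph_dist G g g'" for h g g'
  proof (rule antisym)
    show "graph_dist K (f h g) (f h g') \<le> graph_dist G g g'"
      by (rule graph_dist_image_le[OF G(1) K(1)]) (auto simp: K arcs)
    have "\<pi> x = \<pi> y \<or> (\<pi> x, \<pi> y) \<in> parcs G" if "(x, y) \<in> parcs K" for x y
      using that surj[of x] surj[of y] by (auto simp: \<pi> arcs)
    then have "graph_dist G (\<pi> (f h g)) (\<pi> (f h g')) \<le> graph_dist K (f h g) (f h g')"
      by (intro graph_dist_image_le[OF K(1) G(1)]) (auto simp: G)
    then show "graph_dist G g g' \<le> graph_dist K (f h g) (f h g')" by (simp add: \<pi>)
  qed
  have "distance_matrix G i \<in> span (range (matrix_power (distance_matrix G 1)))" if "1 \<le> i" for i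
  proof -
    \<comment> \<open>every layer is isometric to \<open>G\<close>, so any diagonal block serves\<close>
    have "distance_matrix G i = block f (distance_matrix K i) undefined undefined"
      by (simp add: distance_matrix_def block_def layer vec_eq_iff)
    then show ?thesis
      using blocks_of_polynomial[OF f blocks distance_matrix_in_span_powers[OF DP K(2) that]]
      by simp
  qed
  then show ?thesis by (simp add: distance_polynomial_graph_def polynomial_iff_span)
qed

theorem theorem3p11:
  fixes G :: "'a::finite pair_pre_digraph" and H :: "'b::finite pair_pre_digraph"
  assumes "pair_graph G" and "Digraph_Component.connected (with_proj G)" and "pverts G = UNIV"
    and "pair_graph H" and "Digraph_Component.connected (with_proj H)" and "pverts H = UNIV"
    and "distance_polynomial_graph (G \<boxtimes> H)"
  shows "distance_polynomial_graph G \<and> distance_polynomial_graph H"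
proof
  have K: "pair_graph (G \<boxtimes> H)" "pverts (G \<boxtimes> H) = UNIV"
    using pair_graph_strong_product[OF assms(1,4)] assms(3,6)
    by (auto simp: strong_product_def)
  have "bij (\<lambda>(h :: 'b, g :: 'a). (g, h))"
    by (rule bij_betw_byWitness[where f' = "\<lambda>(g, h). (h, g)"]) auto
  from distance_polynomial_factor[OF assms(1,3,4) K this _ assms(7)]
  show "distance_polynomial_graph G"
    using assms(3,6) by (auto simp: strong_product_def)
  have "bij (\<lambda>(g :: 'a, h :: 'b). (g, h))"
    by (rule bij_betw_byWitness[where f' = id]) auto
  from distance_polynomial_factor[OF assms(4,6,1) K this _ assms(7)]
  show "distance_polynomial_graph H"
    using assms(3,6) by (auto simp: strong_product_def)
qed

end
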